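(* Let $Y$ be a graph that is a generalized truncation of some multigraph. If $Y$ has a unique isolating perfect matching $M$, and for any two distinct components of $Y\setminus M$ there is at least one edge of $M$ joining them, then $|\mathrm{src}(Y)|=1$.
   Context: A multigraph may have multiple edges but no loops; a graph has neither loops nor multiple edges. Multigraphs from which generalized truncations are formed are assumed to have no isolated vertices. Generalized truncation: let $X$ be a multigraph. Take a matching $M_0$ with $|M_0|=|E(X)|$ (on $2|E(X)|$ new vertices) and a bijection $F:E(X)\to M_0$; for each edge $e$ of $X$ with ends $u,v$, label one end of $F(e)$ by $u$ and the other by $v$. For $v\in V(X)$, the cluster $\mathrm{cl}(v)$ is the set of vertices labelled $v$; insert an arbitrary graph $\mathrm{con}(v)$ on $\mathrm{cl}(v)$. The graph $F(M_0)\cup\bigcup_v\mathrm{con}(v)$, and any graph isomorphic to it, is a generalized truncation of $X$. For a graph $Y$, the source $\mathrm{src}(Y)$ is the set of multigraphs $X$ (without loops, considered up to isomorphism) such that $Y$ is a generalized truncation of $X$. $Y\setminus M$ denotes $Y$ with the edges of $M$ deleted. A perfect matching $M$ of $Y$ is isolating if no edge of $M$ has both end vertices in the same component of $Y\setminus M$. *)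

theory Defs
  imports Main
begin

record 'a graph =
  gverts :: "'a set"
  gedges :: "'a set set"

definition is_graph :: "'a graph \<Rightarrow> bool" where
  "is_graph Y \<longleftrightarrow> (\<forall>e \<in> gedges Y. e \<subseteq> gverts Y \<and> card e = 2)"

definition graph_iso :: "'a graph \<Rightarrow> 'b graph \<Rightarrow> bool" where
  "graph_iso Y Z \<longleftrightarrow>
     (\<exists>f. bij_betw f (gverts Y) (gverts Z) \<and> gedges Z = (\<lambda>e. f ` e) ` gedges Y)"

definition delete_edges :: "'a graph \<Rightarrow> 'a set set \<Rightarrow> 'a graph" where
  "delete_edges Y M = Y\<lparr>gedges := gedges Y - M\<rparr>"

definition connected_rel :: "'a graph \<Rightarrow> ('a \<times> 'a) set" where
  "connected_rel Y =
     {(u, v). u \<in> gverts Y \<and> v \<in> gverts Y \<and> (u, v) \<in> {(x, y). {x, y} \<in> gedges Y}\<^sup>*}"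

definition components :: "'a graph \<Rightarrow> 'a set set" where
  "components Y = gverts Y // connected_rel Y"

definition matching :: "'a set set \<Rightarrow> bool" where
  "matching M \<longleftrightarrow> (\<forall>e \<in> M. card e = 2) \<and> pairwise disjnt M"

definition perfect_matching :: "'a graph \<Rightarrow> 'a set set \<Rightarrow> bool" where
  "perfect_matching Y M \<longleftrightarrow> M \<subseteq> gedges Y \<and> matching M \<and> \<Union>M = gverts Y"

definition isolating_perfect_matching :: "'a graph \<Rightarrow> 'a set set \<Rightarrow> bool" where
  "isolating_perfect_matching Y M \<longleftrightarrow>
     perfect_matching Y M \<and> (\<forall>e \<in> M. \<not> (\<exists>C \<in> components (delete_edges Y M). e \<subseteq> C))"

text \<open>Parallel edges are distinct elements of \<open>edges\<close> with the same set of ends; each edge has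
  exactly two ends, which excludes loops.\<close>

record ('v, 'e) multigraph =
  verts :: "'v set"
  edges :: "'e set"
  ends :: "'e \<Rightarrow> 'v set"

definition is_multigraph :: "('v, 'e) multigraph \<Rightarrow> bool" where
  "is_multigraph X \<longleftrightarrow> (\<forall>e \<in> edges X. ends X e \<subseteq> verts X \<and> card (ends X e) = 2)"

definition no_isolated_vertices :: "('v, 'e) multigraph \<Rightarrow> bool" where
  "no_isolated_vertices X \<longleftrightarrow> (\<forall>v \<in> verts X. \<exists>e \<in> edges X. v \<in> ends X e)"

definition multigraph_iso :: "('v, 'e) multigraph \<Rightarrow> ('w, 'f) multigraph \<Rightarrow> bool" where
  "multigraph_iso X X' \<longleftrightarrow>
     (\<exists>f g. bij_betw f (verts X) (verts X') \<and> bij_betw g (edges X) (edges X') \<and>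
        (\<forall>e \<in> edges X. ends X' (g e) = f ` ends X e))"

definition cluster :: "'a set set \<Rightarrow> ('a \<Rightarrow> 'v) \<Rightarrow> 'v \<Rightarrow> 'a set" where
  "cluster M\<^sub>0 lab v = {x \<in> \<Union>M\<^sub>0. lab x = v}"

definition truncation_data ::
  "('v, 'e) multigraph \<Rightarrow> 'a set set \<Rightarrow> ('e \<Rightarrow> 'a set) \<Rightarrow> ('a \<Rightarrow> 'v) \<Rightarrow> ('v \<Rightarrow> 'a graph) \<Rightarrow> bool"
where
  "truncation_data X M\<^sub>0 F lab con \<longleftrightarrow>
     matching M\<^sub>0 \<and> bij_betw F (edges X) M\<^sub>0 \<and>
     (\<forall>e \<in> edges X. bij_betw lab (F e) (ends X e)) \<and>
     (\<forall>v \<in> verts X. is_graph (con v) \<and> gverts (con v) = cluster M\<^sub>0 lab v)"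

definition truncation_graph ::
  "('v, 'e) multigraph \<Rightarrow> 'a set set \<Rightarrow> ('v \<Rightarrow> 'a graph) \<Rightarrow> 'a graph"
where
  "truncation_graph X M\<^sub>0 con =
     \<lparr>gverts = \<Union>M\<^sub>0, gedges = M\<^sub>0 \<union> (\<Union>v \<in> verts X. gedges (con v))\<rparr>"

text \<open>The new vertices are drawn from the vertex type of \<open>Y\<close>. This is no restriction, since the
  constructed graph has to be isomorphic to \<open>Y\<close>.\<close>

definition generalized_truncation :: "('v, 'e) multigraph \<Rightarrow> 'a graph \<Rightarrow> bool" where
  "generalized_truncation X Y \<longleftrightarrow>
     is_multigraph X \<and> no_isolated_vertices X \<and>
     (\<exists>(M\<^sub>0 :: 'a set set) F lab con.
        truncation_data X M\<^sub>0 F lab con \<and> graph_iso (truncation_graph X M\<^sub>0 con) Y)"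

definition multigraph_iso_rel :: "(('v, 'e) multigraph \<times> ('v, 'e) multigraph) set" where
  "multigraph_iso_rel = {(X, X'). is_multigraph X \<and> is_multigraph X' \<and> multigraph_iso X X'}"

text \<open>The elements of the source are isomorphism classes. The types \<open>'v\<close> and \<open>'e\<close>, from which
  the vertices and edges of the multigraphs are taken, are left arbitrary.\<close>

definition src :: "'a graph \<Rightarrow> ('v, 'e) multigraph set set" where
  "src Y = {X. generalized_truncation X Y} // multigraph_iso_rel"

end

theory Submission
  imports Defs
begin

text \<open>If \<open>Y\<close> is a generalized truncation of \<open>X\<close>, the edges of \<open>X\<close> become an isolating perfect
  matching of \<open>Y\<close>, hence \<open>M\<close>, and the labelling of the vertices of \<open>Y\<close> by vertices of \<open>X\<close> is
  constant on the components of \<open>Y \ M\<close>. As any two components are joined by an edge of \<open>M\<close>, whose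
  ends carry different labels, the labelling also separates components. So \<open>X\<close> is determined up
  to isomorphism: it arises from \<open>Y\<close> by contracting the components of \<open>Y \ M\<close>.\<close>

lemma multigraph_iso_trans:
  assumes "multigraph_iso X X'" "multigraph_iso X' X''"
  shows "multigraph_iso X X''"
proof -
  obtain f g where f: "bij_betw f (verts X) (verts X')" and g: "bij_betw g (edges X) (edges X')"
    and fg: "\<And>e. e \<in> edges X \<Longrightarrow> ends X' (g e) = f ` ends X e"
    using assms(1) unfolding multigraph_iso_def by blast
  obtain f' g' where f': "bij_betw f' (verts X') (verts X'')"
    and g': "bij_betw g' (edges X') (edges X'')"
    and fg': "\<And>e. e \<in> edges X' \<Longrightarrow> ends X'' (g' e) = f' ` ends X' e"
    using assms(2) unfolding multigraph_iso_def by blast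
  have "\<forall>e \<in> edges X. ends X'' ((g' \<circ> g) e) = (f' \<circ> f) ` ends X e"
    using fg fg' bij_betw_apply[OF g] by (simp add: image_comp)
  then show ?thesis
    using bij_betw_trans[OF f f'] bij_betw_trans[OF g g'] unfolding multigraph_iso_def by blast
qed

lemma trans_multigraph_iso_rel: "trans multigraph_iso_rel"
  by (auto simp: trans_def multigraph_iso_rel_def intro: multigraph_iso_trans)

text \<open>Transitivity, applied in both directions between \<open>x\<close> and a fixed
  \<open>a\<close>, makes all images under \<open>r\<close> of points of \<open>A\<close> the same
  set, even where these images reach outside \<open>A\<close>.\<close>

lemma card_quotient_eq_1:
  assumes "trans r" "A \<noteq> {}" and rel: "\<And>x y. x \<in> A \<Longrightarrow> y \<in> A \<Longrightarrow> (x, y) \<in> r"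
  shows "card (A // r) = 1"
proof -
  obtain a where a: "a \<in> A"
    using assms(2) by blast
  have "r `` {x} = r `` {a}" if x: "x \<in> A" for x
  proof
    show "r `` {x} \<subseteq> r `` {a}"
      using transD[OF assms(1) rel[OF a x]] by blast
    show "r `` {a} \<subseteq> r `` {x}"
      using transD[OF assms(1) rel[OF x a]] by blast
  qed
  then have "A // r = {r `` {a}}"
    unfolding quotient_def using a by blast
  then show ?thesis
    by simp
qed

text \<open>Transporting the truncation data along the isomorphism to \<open>Y\<close> expresses
  them on the vertices of \<open>Y\<close> itself, so that two truncations with the same graph can
  be compared.\<close>

lemma truncation_labelling:
  fixes X :: "('v, 'e) multigraph" and Y :: "'a graph"
  assumes "generalized_truncation X Y"
  shows "\<exists>N G L. isolating_perfect_matching Y N \<and> bij_betw G (edges X) N \<and>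
    L ` gverts Y = verts X \<and> (\<forall>e \<in> edges X. L ` G e = ends X e) \<and>
    (\<forall>x y. (x, y) \<in> connected_rel (delete_edges Y N) \<longrightarrow> L x = L y) \<and>
    (\<forall>x y. {x, y} \<in> N \<longrightarrow> L x \<noteq> L y)"
proof -
  from assms obtain M\<^sub>0 :: "'a set set" and F lab con
    where X: "is_multigraph X" "no_isolated_vertices X"
      and data: "truncation_data X M\<^sub>0 F lab con"
      and iso: "graph_iso (truncation_graph X M\<^sub>0 con) Y"
    unfolding generalized_truncation_def by blast
  from iso obtain \<phi> where \<phi>: "bij_betw \<phi> (\<Union>M\<^sub>0) (gverts Y)"
    and E: "gedges Y = (`) \<phi> ` (M\<^sub>0 \<union> (\<Union>v \<in> verts X. gedges (con v)))"
    unfolding graph_iso_def truncation_graph_def by auto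
  have inj: "inj_on \<phi> (\<Union>M\<^sub>0)" and im: "\<phi> ` \<Union>M\<^sub>0 = gverts Y"
    using \<phi> by (auto simp: bij_betw_def)
  have M\<^sub>0: "\<And>c. c \<in> M\<^sub>0 \<Longrightarrow> card c = 2" "pairwise disjnt M\<^sub>0"
    and F: "bij_betw F (edges X) M\<^sub>0"
    and lab: "\<And>e. e \<in> edges X \<Longrightarrow> bij_betw lab (F e) (ends X e)"
    and con: "\<And>v. v \<in> verts X \<Longrightarrow> is_graph (con v)"
      "\<And>v. v \<in> verts X \<Longrightarrow> gverts (con v) = cluster M\<^sub>0 lab v"
    using data unfolding truncation_data_def matching_def by auto
  \<comment> \<open>The images of the matching, the edge bijection and the labelling under
    \<open>\<phi>\<close>; \<open>L\<close> gives a vertex of \<open>Y\<close> the label of its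
    preimage.\<close>
  define N where "N = (`) \<phi> ` M\<^sub>0"
  define G where "G = (`) \<phi> \<circ> F"
  define L where "L = lab \<circ> inv_into (\<Union>M\<^sub>0) \<phi>"
  have L: "L (\<phi> x) = lab x" if "x \<in> \<Union>M\<^sub>0" for x
    using inv_into_f_f[OF inj that] by (simp add: L_def)
  have FM: "F e \<in> M\<^sub>0" if "e \<in> edges X" for e
    using F that by (auto simp: bij_betw_def)
  have card_N: "card d = 2" if "d \<in> N" for d
  proof -
    obtain c where c: "c \<in> M\<^sub>0" "d = \<phi> ` c"
      using \<open>d \<in> N\<close> by (auto simp: N_def)
    have "inj_on \<phi> c"
      by (rule inj_on_subset[OF inj]) (use c in blast)
    then show ?thesis
      using c M\<^sub>0(1) by (simp add: card_image)
  qed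
  have G: "bij_betw G (edges X) N"
    unfolding G_def N_def
    by (rule bij_betw_trans[OF F inj_on_imp_bij_betw[OF inj_on_image[OF inj]]])
  have LG: "L ` G e = ends X e" if "e \<in> edges X" for e
  proof -
    have "L ` G e = lab ` F e"
      using FM[OF that] L by (auto simp: G_def image_comp intro!: image_cong)
    then show ?thesis
      using lab[OF that] by (simp add: bij_betw_def)
  qed
  \<comment> \<open>\<open>X\<close> has no loops, so \<open>L\<close> maps the two-element set
    \<open>d\<close> onto the two ends of an edge of \<open>X\<close>.\<close>
  have inj_L: "inj_on L d" if d: "d \<in> N" for d
  proof -
    obtain e where e: "e \<in> edges X" "d = G e"
      using bij_betw_imp_surj_on[OF G] d by blast
    have "card (L ` d) = 2"
      using e LG X(1) by (simp add: is_multigraph_def)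
    \<comment> \<open>Infinite sets have \<open>card\<close> 0, so cardinality 2 forces
      finiteness.\<close>
    moreover have "finite d"
      using card_N[OF d] card.infinite by fastforce
    ultimately show ?thesis
      using card_N[OF d] by (simp add: eq_card_imp_inj_on)
  qed
  have verts_N: "\<Union>N = gverts Y"
    unfolding N_def im[symmetric] by blast
  have L_verts: "L ` gverts Y = verts X"
  proof
    show "L ` gverts Y \<subseteq> verts X"
    proof
      fix v assume "v \<in> L ` gverts Y"
      then obtain d where "d \<in> N" "v \<in> L ` d"
        unfolding verts_N[symmetric] by blast
      then obtain e where "e \<in> edges X" "v \<in> L ` G e"
        using bij_betw_imp_surj_on[OF G] by blast
      then show "v \<in> verts X"
        using LG X(1) unfolding is_multigraph_def by blast
    qed
    \<comment> \<open>Surjectivity rests on the absence of isolated vertices: the cluster of an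
      isolated vertex would be empty.\<close>
    show "verts X \<subseteq> L ` gverts Y"
    proof
      fix v assume "v \<in> verts X"
      then obtain e where e: "e \<in> edges X" "v \<in> ends X e"
        using X(2) by (auto simp: no_isolated_vertices_def)
      then have "v \<in> L ` G e" "G e \<in> N"
        using LG bij_betw_imp_surj_on[OF G] by blast+
      then show "v \<in> L ` gverts Y"
        unfolding verts_N[symmetric] by blast
    qed
  qed
  \<comment> \<open>An edge outside \<open>N\<close> comes from some \<open>con v\<close>, and all
    vertices of \<open>con v\<close> are labelled \<open>v\<close>.\<close>
  have L_edge: "L x = L y" if xy: "{x, y} \<in> gedges Y - N" for x y
  proof -
    obtain c v where c: "{x, y} = \<phi> ` c" "v \<in> verts X" "c \<in> gedges (con v)"
      using xy unfolding E N_def by blast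
    then have sub: "c \<subseteq> cluster M\<^sub>0 lab v"
      using con by (auto simp: is_graph_def)
    have "L z = v" if "z \<in> {x, y}" for z
      using that sub L unfolding c(1) by (auto simp: cluster_def)
    then show ?thesis
      by simp
  qed
  have L_rel: "L x = L y" if "(x, y) \<in> connected_rel (delete_edges Y N)" for x y
  proof -
    have "(x, y) \<in> {(x, y). {x, y} \<in> gedges Y - N}\<^sup>*"
      using that by (auto simp: connected_rel_def delete_edges_def)
    then show ?thesis
      by induction (use L_edge in auto)
  qed
  have "pairwise disjnt N"
  proof (rule pairwiseI)
    fix d d' assume "d \<in> N" "d' \<in> N" "d \<noteq> d'"
    then obtain c c' where c: "c \<in> M\<^sub>0" "c' \<in> M\<^sub>0" "c \<noteq> c'" "d = \<phi> ` c" "d' = \<phi> ` c'"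
      by (auto simp: N_def)
    then have "c \<inter> c' = {}"
      using M\<^sub>0(2) by (auto simp: pairwise_def disjnt_def)
    moreover have "\<phi> ` (c \<inter> c') = d \<inter> d'"
      unfolding c(4,5) by (rule inj_on_image_Int[OF inj]) (use c in auto)
    ultimately show "disjnt d d'"
      by (simp add: disjnt_def)
  qed
  then have "perfect_matching Y N"
    using card_N verts_N unfolding perfect_matching_def matching_def by (auto simp: N_def E)
  \<comment> \<open>Labels are constant on a component, whereas the two ends of \<open>d\<close>
    have different labels.\<close>
  moreover have "\<not> d \<subseteq> C" if d: "d \<in> N" and C: "C \<in> components (delete_edges Y N)" for d C
  proof
    assume "d \<subseteq> C"
    moreover obtain z where "C = connected_rel (delete_edges Y N) `` {z}"
      using C by (auto simp: components_def quotient_def)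
    ultimately have "L ` d \<subseteq> {L z}"
      using L_rel by fastforce
    then have "card (L ` d) \<le> 1"
      using card_mono[of "{L z}"] by simp
    then show False
      using card_image[OF inj_L[OF d]] card_N[OF d] by simp
  qed
  ultimately have N: "isolating_perfect_matching Y N"
    unfolding isolating_perfect_matching_def by blast
  have "L x \<noteq> L y" if "{x, y} \<in> N" for x y
    using inj_L[OF that] card_N[OF that] by (auto simp: inj_on_def card_insert_if split: if_splits)
  then show ?thesis
    using N G L_verts LG L_rel by blast
qed

text \<open>The right-hand side does not mention \<open>L\<close>: the fibres of such a labelling
  are determined by \<open>Y\<close> and \<open>M\<close> alone.\<close>

lemma labelling_eq_iff_connected:
  assumes comp: "\<And>C D. C \<in> components (delete_edges Y M) \<Longrightarrow> D \<in> components (delete_edges Y M) \<Longrightarrow>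
      C \<noteq> D \<Longrightarrow> \<exists>x \<in> C. \<exists>y \<in> D. {x, y} \<in> M"
    and L_rel: "\<And>x y. (x, y) \<in> connected_rel (delete_edges Y M) \<Longrightarrow> L x = L y"
    and L_M: "\<And>x y. {x, y} \<in> M \<Longrightarrow> L x \<noteq> L y"
    and xy: "x \<in> gverts Y" "y \<in> gverts Y"
  shows "L x = L y \<longleftrightarrow> (x, y) \<in> connected_rel (delete_edges Y M)"
proof
  let ?R = "connected_rel (delete_edges Y M)"
  show "L x = L y" if "(x, y) \<in> ?R"
    using that by (rule L_rel)
  show "(x, y) \<in> ?R" if "L x = L y"
  proof (rule ccontr)
    assume "(x, y) \<notin> ?R"
    \<comment> \<open>By reflexivity \<open>y\<close> lies in its own class but not in that of
      \<open>x\<close>, so the two classes are distinct components.\<close>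
    moreover have "(y, y) \<in> ?R"
      using xy by (auto simp: connected_rel_def delete_edges_def)
    ultimately have "?R `` {x} \<noteq> ?R `` {y}"
      by blast
    moreover have "?R `` {x} \<in> components (delete_edges Y M)" "?R `` {y} \<in> components (delete_edges Y M)"
      using xy by (auto simp: components_def delete_edges_def intro: quotientI)
    ultimately obtain x' y' where xy': "(x, x') \<in> ?R" "(y, y') \<in> ?R" "{x', y'} \<in> M"
      using comp by blast
    then show False
      using L_rel[OF xy'(1)] L_rel[OF xy'(2)] L_M[OF xy'(3)] that by simp
  qed
qed

text \<open>Labellings with the same fibres identify the vertex sets by sending \<open>L x\<close>
  to \<open>L' x\<close>; edges of \<open>X\<close> and \<open>X'\<close> correspond when they come
  from the same edge of \<open>M\<close>.\<close>

lemma multigraph_iso_of_labellings: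
  assumes G: "bij_betw G (edges X) M" and G': "bij_betw G' (edges X') M"
    and L: "L ` V = verts X" and L': "L' ` V = verts X'"
    and LG: "\<And>e. e \<in> edges X \<Longrightarrow> L ` G e = ends X e"
    and LG': "\<And>e. e \<in> edges X' \<Longrightarrow> L' ` G' e = ends X' e"
    and M: "\<Union>M \<subseteq> V"
    and eq: "\<And>x y. x \<in> V \<Longrightarrow> y \<in> V \<Longrightarrow> L x = L y \<longleftrightarrow> L' x = L' y"
  shows "multigraph_iso X X'"
proof -
  define f where "f = L' \<circ> inv_into V L"
  define g where "g = inv_into (edges X') G' \<circ> G"
  \<comment> \<open>\<open>inv_into\<close> picks some vertex labelled \<open>L x\<close>; by
    \<open>eq\<close>, every such vertex has the same label under \<open>L'\<close>.\<close>
  have fL: "f (L x) = L' x" if "x \<in> V" for x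
    using that eq[of "inv_into V L (L x)" x]
    by (simp add: f_def inv_into_into f_inv_into_f)
  have "bij_betw f (verts X) (verts X')"
    unfolding bij_betw_def L[symmetric] L'[symmetric]
    by (auto simp: inj_on_def fL eq image_comp intro!: image_cong)
  moreover have g: "bij_betw g (edges X) (edges X')"
    unfolding g_def using bij_betw_trans[OF G bij_betw_inv_into[OF G']] .
  moreover have "ends X' (g e) = f ` ends X e" if e: "e \<in> edges X" for e
  proof -
    have "G e \<in> M" "g e \<in> edges X'"
      using G g e by (auto simp: bij_betw_def)
    \<comment> \<open>Both edges are represented by one edge of \<open>M\<close>, so their ends are
      its images under \<open>L\<close> and \<open>L'\<close>.\<close>
    moreover have "G' (g e) = G e"
      using G' \<open>G e \<in> M\<close> by (simp add: g_def bij_betw_def f_inv_into_f)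
    ultimately have "ends X' (g e) = L' ` G e" "G e \<subseteq> V"
      using LG'[of "g e"] M by (simp, blast)
    moreover have "f ` L ` G e = L' ` G e"
      using fL \<open>G e \<subseteq> V\<close> by (auto simp: image_comp intro!: image_cong)
    ultimately show ?thesis
      using LG[OF e] by simp
  qed
  ultimately show ?thesis
    unfolding multigraph_iso_def by blast
qed

theorem theorem2p8:
  fixes Y :: "'a graph" and M :: "'a set set"
  assumes "is_graph Y"
    and "\<exists>X :: ('v, 'e) multigraph. generalized_truncation X Y"
    and "isolating_perfect_matching Y M"
    and "\<And>N. isolating_perfect_matching Y N \<Longrightarrow> N = M"
    and "\<And>C D. C \<in> components (delete_edges Y M) \<Longrightarrow> D \<in> components (delete_edges Y M) \<Longrightarrow>
           C \<noteq> D \<Longrightarrow> \<exists>x \<in> C. \<exists>y \<in> D. {x, y} \<in> M"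
  shows "card (src Y :: ('v, 'e) multigraph set set) = 1"
proof -
  have "(X, X') \<in> multigraph_iso_rel"
    if X: "generalized_truncation X Y" and X': "generalized_truncation X' Y"
    for X X' :: "('v, 'e) multigraph"
  proof -
    obtain N G L where N: "isolating_perfect_matching Y N"
      and G: "bij_betw G (edges X) N" and L: "L ` gverts Y = verts X"
      and LG: "\<forall>e \<in> edges X. L ` G e = ends X e"
      and sep: "\<forall>x y. (x, y) \<in> connected_rel (delete_edges Y N) \<longrightarrow> L x = L y"
        "\<forall>x y. {x, y} \<in> N \<longrightarrow> L x \<noteq> L y"
      using truncation_labelling[OF X] by blast
    obtain N' G' L' where N': "isolating_perfect_matching Y N'"
      and G': "bij_betw G' (edges X') N'" and L': "L' ` gverts Y = verts X'"
      and LG': "\<forall>e \<in> edges X'. L' ` G' e = ends X' e"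
      and sep': "\<forall>x y. (x, y) \<in> connected_rel (delete_edges Y N') \<longrightarrow> L' x = L' y"
        "\<forall>x y. {x, y} \<in> N' \<longrightarrow> L' x \<noteq> L' y"
      using truncation_labelling[OF X'] by blast
    \<comment> \<open>Uniqueness puts both labellings over the same matching, hence over the same
      components.\<close>
    have NM: "N = M" "N' = M"
      using assms(4) N N' by auto
    have "L x = L y \<longleftrightarrow> L' x = L' y" if "x \<in> gverts Y" "y \<in> gverts Y" for x y
      using labelling_eq_iff_connected[where L = L, OF assms(5) sep[unfolded NM, rule_format] that]
        labelling_eq_iff_connected[where L = L', OF assms(5) sep'[unfolded NM, rule_format] that] by simp
    moreover have "\<Union>M \<subseteq> gverts Y"
      using assms(3) by (simp add: isolating_perfect_matching_def perfect_matching_def)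
    ultimately have "multigraph_iso X X'"
      by (intro multigraph_iso_of_labellings[where L = L and L' = L', OF G[unfolded NM] G'[unfolded NM] L L' LG[rule_format] LG'[rule_format]])
    then show ?thesis
      using X X' by (simp add: multigraph_iso_rel_def generalized_truncation_def)
  qed
  then show ?thesis
    \<comment> \<open>The assumed truncation source has the same types \<open>'v\<close> and
      \<open>'e\<close> as \<open>src Y\<close>, so the set being partitioned is nonempty.\<close>
    unfolding src_def using assms(2)
    by (intro card_quotient_eq_1 trans_multigraph_iso_rel) auto
qed

end
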